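(* Let $q$ be an odd positive integer, $m\in\mathbb{N}$, $N=q\,2^m$, and let $\mu(q)\ge 0$ be the number of multiplications used for the $q$-point DCT-II. The number of multiplications of C.\,W.~Kok's algorithm for the $N$-point DCT-II, namely $2^m\mu(q)+\tfrac{m}{2}N$, equals the multiplicative complexity theoretically achievable by the prime-factor decomposition, namely $2^m\mu(q)+q\left(2^{m+1}-m-2\right)$, if and only if $m\le 2$.
   Context: The $N$-point DCT-II is $[C^{II}_N]_{n,k}=\cos\left(\frac{\pi(2n+1)k}{2N}\right)$, $n,k=0,\dots,N-1$. C.\,W.~Kok's algorithm computes it recursively via $C^{II}_N=P_N\begin{pmatrix}C^{II}_{N/2}&0\\0&R_{N/2}C^{II}_{N/2}D_{N/2}J_{N/2}\end{pmatrix}B_N$ (with $P_N$ an even/odd permutation, $B_N$ a butterfly, $R_{N/2}$ a matrix of recursive subtractions, $D_{N/2}=\mathrm{diag}(2\cos\frac{(2i+1)\pi}{2N})$, $J_{N/2}$ order reversal), applied $m$ times down to length $q$, giving $2^m\mu(q)+\tfrac{m}{2}N$ multiplications. The prime-factor decomposition computes the length-$q2^m$ DCT-II from $2^m$ transforms of length $q$ and $q$ transforms of length $2^m$, using $2^m\mu(q)+q\,\mu(2^m)$ multiplications, and any $2^m$-point DCT-II requires $\mu(2^m)\ge 2^{m+1}-m-2$ multiplications, so the best achievable prime-factor count is $2^m\mu(q)+q(2^{m+1}-m-2)$. *)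

theory Defs
  imports
    "HOL-Analysis.Analysis"
    "HOL-Computational_Algebra.Euclidean_Algorithm"
    "Jordan_Normal_Form.Matrix"
begin

hide_const (open) Finite_Cartesian_Product.mat Finite_Cartesian_Product.row
  Finite_Cartesian_Product.column Determinants.det

(* Rows are indexed by frequencies k and columns by samples n, so that the transform of
   the column vector x is dct2 N * x. *)
definition dct2 :: "nat \<Rightarrow> real mat" where
  "dct2 N = Matrix.mat N N (\<lambda>(k, n). cos (pi * real ((2 * n + 1) * k) / real (2 * N)))"

(* Algorithms for linear maps, given as structured matrix factorizations.
     Free M    additions, permutations and multiplications by rational constants
     Diag n d  multiplication of the i-th component by the constant d i, for i < n
     DCT n c   call of some n-point DCT-II routine that uses c multiplications
     Seq A B   first B, then A (matrix product)
     Par A B   direct sum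
     Rep n A   direct sum of n copies of A
   As usual in the theory of multiplicative complexity, rational operations are free; each
   entry of a diagonal stage counts as one multiplication. *)
datatype algo =
    Free "rat mat"
  | Diag nat "nat \<Rightarrow> real"
  | DCT nat nat
  | Seq algo algo (infixr "\<odot>" 70)
  | Par algo algo
  | Rep nat algo

definition copies_mat :: "nat \<Rightarrow> real mat \<Rightarrow> real mat" where
  "copies_mat n A = Matrix.mat (n * dim_row A) (n * dim_col A)
     (\<lambda>(i, j). if i div dim_row A = j div dim_col A
               then A $$ (i mod dim_row A, j mod dim_col A) else 0)"

primrec matrix_of :: "algo \<Rightarrow> real mat" where
  "matrix_of (Free M) = map_mat of_rat M"
| "matrix_of (Diag n d) = mat_diag n d"
| "matrix_of (DCT n c) = dct2 n"
| "matrix_of (A \<odot> B) = matrix_of A * matrix_of B"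
| "matrix_of (Par A B) =
     four_block_mat (matrix_of A) (0\<^sub>m (dim_row (matrix_of A)) (dim_col (matrix_of B)))
       (0\<^sub>m (dim_row (matrix_of B)) (dim_col (matrix_of A))) (matrix_of B)"
| "matrix_of (Rep n A) = copies_mat n (matrix_of A)"

primrec mults :: "algo \<Rightarrow> nat" where
  "mults (Free M) = 0"
| "mults (Diag n d) = n"
| "mults (DCT n c) = c"
| "mults (A \<odot> B) = mults A + mults B"
| "mults (Par A B) = mults A + mults B"
| "mults (Rep n A) = n * mults A"


section \<open>Kok's algorithm\<close>

definition reversal :: "nat \<Rightarrow> rat mat" where
  "reversal h = Matrix.mat h h (\<lambda>(i, j). if i + j + 1 = h then 1 else 0)"

definition butterfly :: "nat \<Rightarrow> rat mat" where
  "butterfly h = four_block_mat (1\<^sub>m h) (reversal h) (reversal h) (- (1\<^sub>m h))"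

(* Moves the first half of the components to the even positions, the second half to the odd ones. *)
definition even_odd_perm :: "nat \<Rightarrow> rat mat" where
  "even_odd_perm h = Matrix.mat (2 * h) (2 * h)
     (\<lambda>(i, j). if j = (if even i then i div 2 else h + i div 2) then 1 else 0)"

(* Solves X_1 = G_0 / 2 and X_(2k+1) = G_k - X_(2k-1) for the odd components X_(2k+1);
   the recursion reflects 2 cos t cos(2kt) = cos((2k+1)t) + cos((2k-1)t). *)
definition rec_subtractions :: "nat \<Rightarrow> rat mat" where
  "rec_subtractions h = Matrix.mat h h
     (\<lambda>(k, j). if j = 0 then (-1) ^ k / 2 else if j \<le> k then (-1) ^ (k - j) else 0)"

(* m levels of recursion, for length q * 2 ^ m, on top of a q-point DCT-II routine
   with mu multiplications. *)
primrec kok :: "nat \<Rightarrow> nat \<Rightarrow> nat \<Rightarrow> algo" where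
  "kok q \<mu> 0 = DCT q \<mu>"
| "kok q \<mu> (Suc m) =
     (let h = q * 2 ^ m; N = 2 * h in
        Free (even_odd_perm h)
        \<odot> Par (kok q \<mu> m)
              (Free (rec_subtractions h) \<odot> kok q \<mu> m
               \<odot> Diag h (\<lambda>i. 2 * cos (real (2 * i + 1) * pi / real (2 * N)))
               \<odot> Free (reversal h))
        \<odot> Free (butterfly h))"


section \<open>The prime-factor decomposition\<close>

(* For t = 2 n + 1 one has cos(pi t k / (2 p)) = cos(pi (2 n' + 1) k / (2 p))
   with n' = fold_index p n < p. *)
definition fold_index :: "nat \<Rightarrow> nat \<Rightarrow> nat" where
  "fold_index p n = (if n mod (2 * p) < p then n mod (2 * p) else 2 * p - 1 - n mod (2 * p))"

(* Expresses an arbitrary integer frequency a through the frequencies j < p: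
   for odd t, cos(pi t a / (2 p)) is the sum over j < p of
   freq_coeff p a j * cos(pi t j / (2 p)). *)
definition freq_coeff :: "nat \<Rightarrow> int \<Rightarrow> nat \<Rightarrow> rat" where
  "freq_coeff p a j =
     (if 4 * int p dvd a - int j \<or> 4 * int p dvd a + int j then 1
      else if 4 * int p dvd a - int j - 2 * int p \<or> 4 * int p dvd a + int j - 2 * int p then -1
      else 0)"

(* Sample n of the input becomes entry (fold_index p n, fold_index r n) of a p * r array,
   whose (i, j) entry is stored at position j * p + i. *)
definition pf_input :: "nat \<Rightarrow> nat \<Rightarrow> rat mat" where
  "pf_input p r = Matrix.mat (p * r) (p * r)
     (\<lambda>(i, n). if i = fold_index r n * p + fold_index p n then 1 else 0)"

definition pf_transpose :: "nat \<Rightarrow> nat \<Rightarrow> rat mat" where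
  "pf_transpose p r = Matrix.mat (p * r) (p * r)
     (\<lambda>(i, j). if i div r = j mod p \<and> i mod r = j div p then 1 else 0)"

(* With k = a r + b p, the output at frequency k is Y(a, b) - Y(p - a, r - b), where Y is the
   two-dimensional transform of the array, extended to all integer frequencies. *)
definition pf_output :: "nat \<Rightarrow> nat \<Rightarrow> rat mat" where
  "pf_output p r = Matrix.mat (p * r) (p * r)
     (\<lambda>(k, l). let (u, v) = bezout_coefficients (int r) (int p); a = int k * u; b = int k * v
        in freq_coeff p a (l div r) * freq_coeff r b (l mod r)
           - freq_coeff p (int p - a) (l div r) * freq_coeff r (int r - b) (l mod r))"

(* For coprime p and r: r transforms of length p (with mu multiplications each), followed by
   p transforms of length r (with nu multiplications each). *)
definition prime_factor :: "nat \<Rightarrow> nat \<Rightarrow> nat \<Rightarrow> nat \<Rightarrow> algo" where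
  "prime_factor p r \<mu> \<nu> =
     Free (pf_output p r) \<odot> Rep p (DCT r \<nu>) \<odot> Free (pf_transpose p r)
     \<odot> Rep r (DCT p \<mu>) \<odot> Free (pf_input p r)"

(* The known lower bound for the number of multiplications of any 2^m-point DCT-II
   (Heideman, Winograd); the subtractions never truncate. *)
definition dct2_pow2_bound :: "nat \<Rightarrow> nat" where
  "dct2_pow2_bound m = 2 ^ (m + 1) - m - 2"

(* The best count achievable by the prime-factor decomposition for length q * 2 ^ m: over all
   multiplication counts nu of the 2^m-point transforms that the lower bound permits. *)
definition prime_factor_best :: "nat \<Rightarrow> nat \<Rightarrow> nat \<Rightarrow> nat" where
  "prime_factor_best q \<mu> m =
     (LEAST c. \<exists>\<nu> \<ge> dct2_pow2_bound m. c = mults (prime_factor q (2 ^ m) \<mu> \<nu>))"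


section \<open>Both algorithms compute the DCT-II\<close>

lemma index_mult_sum:
  fixes A B :: "'a :: semiring_0 mat"
  assumes "i < dim_row A" "j < dim_col B" "dim_col A = dim_row B"
  shows "(A * B) $$ (i, j) = (\<Sum>l<dim_row B. A $$ (i, l) * B $$ (l, j))"
  using assms by (simp add: scalar_prod_def atLeast0LessThan)

lemma dim_dct2 [simp]: "dim_row (dct2 N) = N" "dim_col (dct2 N) = N"
  by (simp_all add: dct2_def)

lemma rec_subtractions_sum:
  fixes t :: real
  assumes "k < h"
  shows "(\<Sum>l<h. of_rat (rec_subtractions h $$ (k, l)) * (2 * cos t * cos (2 * real l * t)))
         = cos ((2 * real k + 1) * t)"
  using assms
proof (induction k)
  case 0
  have "(\<Sum>l<h. of_rat (rec_subtractions h $$ (0, l)) * (2 * cos t * cos (2 * real l * t)))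
     = (\<Sum>l<h. if l = 0 then cos t else 0)"
    using 0 by (intro sum.cong refl) (auto simp: rec_subtractions_def of_rat_divide)
  also have "\<dots> = cos t"
    using 0 by simp
  finally show ?case by simp
next
  case (Suc k)
  let ?f = "\<lambda>l. 2 * cos t * cos (2 * real l * t)"
  have rec: "rec_subtractions h $$ (Suc k, l)
      = (if l = Suc k then 1 else 0) - rec_subtractions h $$ (k, l)" if "l < h" for l
    using that Suc.prems by (simp add: rec_subtractions_def Suc_diff_le)
  have "(\<Sum>l<h. of_rat (rec_subtractions h $$ (Suc k, l)) * ?f l)
     = (\<Sum>l<h. (if l = Suc k then ?f l else 0) - of_rat (rec_subtractions h $$ (k, l)) * ?f l)"
  proof (intro sum.cong refl)
    fix l assume "l \<in> {..<h}"
    hence "rec_subtractions h $$ (Suc k, l)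
        = (if l = Suc k then 1 else 0) - rec_subtractions h $$ (k, l)"
      by (intro rec) simp
    thus "of_rat (rec_subtractions h $$ (Suc k, l)) * ?f l
        = (if l = Suc k then ?f l else 0) - of_rat (rec_subtractions h $$ (k, l)) * ?f l"
      by (cases "l = Suc k") (simp_all only: of_rat_diff of_rat_1 of_rat_0 left_diff_distrib
          if_True if_False mult_1 mult_zero_left simp_thms)
  qed
  also have "\<dots> = ?f (Suc k) - cos ((2 * real k + 1) * t)"
    using Suc.IH Suc.prems by (simp add: sum_subtractf del: of_nat_Suc)
  also have "?f (Suc k) = cos ((2 * real (Suc k) + 1) * t) + cos ((2 * real k + 1) * t)"
    using cos_times_cos[of "2 * real (Suc k) * t" t] by (simp add: algebra_simps)
  finally show ?case by simp
qed

lemma cos_reflect: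
  assumes "0 < h" "n < 2 * h"
  shows "cos (pi * real ((2 * (2 * h - 1 - n) + 1) * k) / real (4 * h))
         = (-1) ^ k * cos (pi * real ((2 * n + 1) * k) / real (4 * h))"
proof -
  have "real (2 * (2 * h - 1 - n) + 1) = 4 * real h - real (2 * n + 1)"
    using assms by (simp add: of_nat_diff)
  hence "pi * real ((2 * (2 * h - 1 - n) + 1) * k) / real (4 * h)
      = pi * real k - pi * real ((2 * n + 1) * k) / real (4 * h)"
    using assms(1) by (simp only: of_nat_mult) (simp add: field_simps)
  thus ?thesis
    by (simp add: cos_diff mult.commute[of pi "real k"])
qed

lemma kok_step:
  assumes h: "0 < h"
  defines "D \<equiv> mat_diag h (\<lambda>i. 2 * cos (real (2 * i + 1) * pi / real (2 * (2 * h))))"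
  defines "W \<equiv> map_mat of_rat (rec_subtractions h) * (dct2 h * (D * map_mat of_rat (reversal h)))"
  shows "map_mat of_rat (even_odd_perm h)
         * (four_block_mat (dct2 h) (0\<^sub>m h h) (0\<^sub>m h h) W * map_mat of_rat (butterfly h))
         = dct2 (2 * h)"
proof -
  define J where "J = Matrix.mat h h (\<lambda>(i, j). if i + j + 1 = h then 1 else 0 :: real)"
  have J: "map_mat of_rat (reversal h) = J"
    unfolding J_def reversal_def by (intro eq_matI) auto
  have [simp]: "dim_row J = h" "dim_col J = h" by (simp_all add: J_def)
  have dimD [simp]: "dim_row D = h" "dim_col D = h" by (simp_all add: D_def mat_diag_def)
  have [simp]: "dim_row (rec_subtractions h) = h" "dim_col (rec_subtractions h) = h"
    by (simp_all add: rec_subtractions_def)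
  have right_J: "(A * J) $$ (i, j) = A $$ (i, h - 1 - j)"
    if "i < dim_row A" "dim_col A = h" "j < h" for A i j
  proof -
    have "(A * J) $$ (i, j) = (\<Sum>l<h. A $$ (i, l) * J $$ (l, j))"
      using that by (subst index_mult_sum) (simp_all del: index_mult_mat(1))
    also have "\<dots> = (\<Sum>l<h. if l = h - 1 - j then A $$ (i, l) else 0)"
      using that by (intro sum.cong refl) (auto simp: J_def)
    also have "\<dots> = A $$ (i, h - 1 - j)"
      using that by simp
    finally show ?thesis .
  qed
  have W: "W = map_mat of_rat (rec_subtractions h) * (dct2 h * D) * J"
    unfolding W_def J
    by (subst assoc_mult_mat[symmetric, of _ h h _ h _ h], auto intro: carrier_matI)+
  have dimW [simp]: "dim_row W = h" "dim_col W = h" by (simp_all add: W)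
  have W_entry: "W $$ (k, j) = cos (pi * real ((2 * (h - 1 - j) + 1) * (2 * k + 1)) / real (4 * h))"
    if k: "k < h" and j: "j < h" for k j
  proof -
    define i where "i = h - 1 - j"
    have i: "i < h" using h by (simp add: i_def)
    define t where "t = real (2 * i + 1) * pi / real (4 * h)"
    have CD: "(dct2 h * D) $$ (l, i) = 2 * cos t * cos (2 * real l * t)" if l: "l < h" for l
    proof -
      have "dct2 h * D = Matrix.mat h h (\<lambda>(i, j). dct2 h $$ (i, j) *
              (2 * cos (real (2 * j + 1) * pi / real (2 * (2 * h)))))"
        unfolding D_def by (rule mat_diag_mult_right) (auto intro: carrier_matI)
      hence "(dct2 h * D) $$ (l, i) = dct2 h $$ (l, i) * (2 * cos t)"
        using l i by (simp add: t_def)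
      also have "dct2 h $$ (l, i) = cos (2 * real l * t)"
      proof -
        have "pi * real ((2 * i + 1) * l) / real (2 * h) = 2 * real l * t"
          using h by (simp add: t_def field_simps)
        thus ?thesis using l i by (simp add: dct2_def)
      qed
      finally show ?thesis by simp
    qed
    have "W $$ (k, j) = (map_mat of_rat (rec_subtractions h) * (dct2 h * D)) $$ (k, i)"
      unfolding W i_def using k j by (subst right_J) auto
    also have "\<dots> = (\<Sum>l<h. of_rat (rec_subtractions h $$ (k, l)) * (dct2 h * D) $$ (l, i))"
      using k i by (subst index_mult_sum) (auto simp del: index_mult_mat(1))
    also have "\<dots> = (\<Sum>l<h. of_rat (rec_subtractions h $$ (k, l)) * (2 * cos t * cos (2 * real l * t)))"
      by (intro sum.cong refl) (simp only: CD lessThan_iff)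
    also have "\<dots> = cos ((2 * real k + 1) * t)"
      by (rule rec_subtractions_sum[OF k])
    also have "(2 * real k + 1) * t = pi * real ((2 * i + 1) * (2 * k + 1)) / real (4 * h)"
      by (simp add: t_def field_simps)
    finally show ?thesis by (simp add: i_def)
  qed
  have B: "map_mat of_rat (butterfly h) = four_block_mat (1\<^sub>m h) J J (- (1\<^sub>m h))"
    unfolding butterfly_def J[symmetric]
    by (intro eq_matI) (auto simp: reversal_def of_rat_minus)
  have carr: "dct2 h \<in> carrier_mat h h" "W \<in> carrier_mat h h" "J \<in> carrier_mat h h"
    by (auto intro: carrier_matI)
  have "four_block_mat (dct2 h) (0\<^sub>m h h) (0\<^sub>m h h) W * four_block_mat (1\<^sub>m h) J J (- (1\<^sub>m h))
      = four_block_mat (dct2 h * 1\<^sub>m h + 0\<^sub>m h h * J) (dct2 h * J + 0\<^sub>m h h * (- (1\<^sub>m h)))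
          (0\<^sub>m h h * 1\<^sub>m h + W * J) (0\<^sub>m h h * J + W * (- (1\<^sub>m h)))"
    by (rule mult_four_block_mat[of _ h h _ h _ h _ _ h _ h]) (use carr in auto)
  also have "\<dots> = four_block_mat (dct2 h) (dct2 h * J) (W * J) (- W)"
  proof -
    have "dct2 h * 1\<^sub>m h + 0\<^sub>m h h * J = dct2 h" "0\<^sub>m h h * 1\<^sub>m h + W * J = W * J"
      "dct2 h * J + 0\<^sub>m h h * (- (1\<^sub>m h)) = dct2 h * J" "0\<^sub>m h h * J + W * (- (1\<^sub>m h)) = - W"
    proof -
      have "- (0\<^sub>m h h) = (0\<^sub>m h h :: real mat)" by (intro eq_matI) auto
      thus "dct2 h * 1\<^sub>m h + 0\<^sub>m h h * J = dct2 h" "0\<^sub>m h h * 1\<^sub>m h + W * J = W * J"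
        "dct2 h * J + 0\<^sub>m h h * (- (1\<^sub>m h)) = dct2 h * J" "0\<^sub>m h h * J + W * (- (1\<^sub>m h)) = - W"
        using carr by (simp_all add: mult_carrier_mat)
    qed
    thus ?thesis by (simp only:)
  qed
  finally have block: "four_block_mat (dct2 h) (0\<^sub>m h h) (0\<^sub>m h h) W * map_mat of_rat (butterfly h)
      = four_block_mat (dct2 h) (dct2 h * J) (W * J) (- W)" (is "?L = ?M")
    unfolding B .
  have dct2_half: "dct2 h $$ (k, n) = cos (pi * real ((2 * n + 1) * (2 * k)) / real (4 * h))"
    if "k < h" "n < h" for k n
  proof -
    have "pi * real ((2 * n + 1) * (2 * k)) / real (4 * h)
        = pi * real ((2 * n + 1) * k) / real (2 * h)"
      using h by (simp add: field_simps)
    thus ?thesis using that by (simp add: dct2_def)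
  qed
  have M_even: "?M $$ (k, n) = cos (pi * real ((2 * n + 1) * (2 * k)) / real (4 * h))"
    if "k < h" "n < 2 * h" for k n
  proof (cases "n < h")
    case True
    thus ?thesis using that dct2_half[of k n] by simp
  next
    case False
    hence "?M $$ (k, n) = (dct2 h * J) $$ (k, n - h)"
      using that by (simp del: index_mult_mat(1))
    also have "\<dots> = dct2 h $$ (k, 2 * h - 1 - n)"
      using that False by (subst right_J) (auto simp: mult_2)
    also have "\<dots> = cos (pi * real ((2 * (2 * h - 1 - n) + 1) * (2 * k)) / real (4 * h))"
      using that False by (intro dct2_half) auto
    also have "\<dots> = cos (pi * real ((2 * n + 1) * (2 * k)) / real (4 * h))"
      using that h by (subst cos_reflect) auto
    finally show ?thesis .
  qed
  have M_odd: "?M $$ (h + k, n) = cos (pi * real ((2 * n + 1) * (2 * k + 1)) / real (4 * h))"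
    if "k < h" "n < 2 * h" for k n
  proof (cases "n < h")
    case True
    hence "?M $$ (h + k, n) = (W * J) $$ (k, n)"
      using that by (simp del: index_mult_mat(1))
    also have "\<dots> = W $$ (k, h - 1 - n)"
      using that True by (subst right_J) auto
    also have "\<dots> = cos (pi * real ((2 * n + 1) * (2 * k + 1)) / real (4 * h))"
      using that True h by (subst W_entry) auto
    finally show ?thesis .
  next
    case False
    hence "?M $$ (h + k, n) = - W $$ (k, n - h)"
      using that by simp
    also have "\<dots> = - cos (pi * real ((2 * (2 * h - 1 - n) + 1) * (2 * k + 1)) / real (4 * h))"
    proof -
      have "h - 1 - (n - h) = 2 * h - 1 - n" using False that by simp
      thus ?thesis using that False by (subst W_entry) auto
    qed
    also have "\<dots> = cos (pi * real ((2 * n + 1) * (2 * k + 1)) / real (4 * h))"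
      using that h by (subst cos_reflect) auto
    finally show ?thesis .
  qed
  have dimP: "dim_row (even_odd_perm h) = 2 * h" "dim_col (even_odd_perm h) = 2 * h"
    by (simp_all add: even_odd_perm_def)
  have dimM: "dim_row ?M = 2 * h" "dim_col ?M = 2 * h" by simp_all
  have perm: "(map_mat of_rat (even_odd_perm h) * ?M) $$ (k, n)
      = ?M $$ (if even k then k div 2 else h + k div 2, n)"
    if "k < 2 * h" "n < 2 * h" for k n
  proof -
    let ?s = "if even k then k div 2 else h + k div 2"
    have s: "?s < 2 * h" using that by auto
    have "(map_mat of_rat (even_odd_perm h) * ?M) $$ (k, n)
        = (\<Sum>l<2 * h. map_mat of_rat (even_odd_perm h) $$ (k, l) * ?M $$ (l, n))"
      using that by (subst index_mult_sum) (simp_all only: dimM dimP index_map_mat)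
    also have "\<dots> = (\<Sum>l<2 * h. if l = ?s then ?M $$ (l, n) else 0)"
      using that by (intro sum.cong refl) (simp add: even_odd_perm_def del: index_mat_four_block)
    also have "\<dots> = ?M $$ (?s, n)"
      using s by (simp only: sum.delta finite_lessThan lessThan_iff if_True)
    finally show ?thesis .
  qed
  show ?thesis
    unfolding block
  proof (rule eq_matI)
    fix k n assume "k < dim_row (dct2 (2 * h))" "n < dim_col (dct2 (2 * h))"
    hence k: "k < 2 * h" and n: "n < 2 * h" by simp_all
    have R: "dct2 (2 * h) $$ (k, n) = cos (pi * real ((2 * n + 1) * k) / real (4 * h))"
      using k n by (simp add: dct2_def)
    show "(map_mat of_rat (even_odd_perm h) * ?M) $$ (k, n) = dct2 (2 * h) $$ (k, n)"
    proof (cases "even k")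
      case True
      then obtain l where l: "k = 2 * l" by blast
      thus ?thesis using perm[OF k n] M_even[of l n] k n R by simp
    next
      case False
      then obtain l where l: "k = 2 * l + 1" by (metis oddE)
      thus ?thesis using perm[OF k n] M_odd[of l n] k n R by simp
    qed
  qed (simp_all add: dimP)
qed

theorem matrix_of_kok:
  assumes "0 < q"
  shows "matrix_of (kok q \<mu> m) = dct2 (q * 2 ^ m)"
proof (induction m)
  case (Suc m)
  have "0 < q * 2 ^ m" using assms by simp
  from kok_step[OF this] Suc show ?case
    by (simp add: Let_def rec_subtractions_def reversal_def mult_ac del: index_mult_mat(1))
qed simp


lemma fold_index_less: "0 < p \<Longrightarrow> fold_index p n < p"
  using mod_less_divisor[of "2 * p" n] by (auto simp: fold_index_def)

lemma cos_fold_index: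
  assumes "0 < p"
  shows "cos (pi * real ((2 * fold_index p n + 1) * k) / real (2 * p))
         = cos (pi * real ((2 * n + 1) * k) / real (2 * p))"
proof -
  define s d where "s = n mod (2 * p)" and "d = n div (2 * p)"
  have s: "s < 2 * p" using assms by (simp add: s_def)
  have n: "n = 2 * p * d + s" by (simp add: s_def d_def)
  have "pi * real ((2 * n + 1) * k) / real (2 * p)
      = pi * real ((2 * s + 1) * k) / real (2 * p) + 2 * pi * of_int (int (d * k))"
    using assms by (simp add: n field_simps)
  hence 1: "cos (pi * real ((2 * n + 1) * k) / real (2 * p))
      = cos (pi * real ((2 * s + 1) * k) / real (2 * p))"
    by (simp only: cos_add cos_int_2pin sin_int_2pin mult_1_right mult_zero_right diff_0_right)
  show ?thesis
  proof (cases "s < p")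
    case True
    thus ?thesis using 1 by (simp add: fold_index_def s_def)
  next
    case False
    have "real (2 * (2 * p - 1 - s) + 1) = 4 * real p - real (2 * s + 1)"
      using s by (simp add: of_nat_diff)
    hence "pi * real ((2 * (2 * p - 1 - s) + 1) * k) / real (2 * p)
        = 2 * pi * of_int (int k) - pi * real ((2 * s + 1) * k) / real (2 * p)"
      using assms by (simp only: of_nat_mult) (simp add: field_simps)
    hence "cos (pi * real ((2 * (2 * p - 1 - s) + 1) * k) / real (2 * p))
        = cos (pi * real ((2 * s + 1) * k) / real (2 * p))"
      by (simp only: cos_diff cos_int_2pin sin_int_2pin mult_1_left mult_zero_left add_0_right)
    thus ?thesis using 1 False by (simp add: fold_index_def s_def)
  qed
qed

lemma dvd_small_int:
  fixes x c :: int
  assumes "c dvd x" "- c < x" "x < c"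
  shows "x = 0"
  using assms zdvd_imp_le[of c x] zdvd_imp_le[of c "- x"] by force

lemma freq_coeff_reduced:
  fixes r :: int
  assumes l: "l < p" and r: "0 \<le> r" "r < 4 * int p"
  shows "freq_coeff p r l =
    (if r < int p then (if l = nat r then 1 else 0)
     else if r = int p \<or> r = 3 * int p then 0
     else if r < 2 * int p then (if l = nat (2 * int p - r) then -1 else 0)
     else if r < 3 * int p then (if l = nat (r - 2 * int p) then -1 else 0)
     else (if l = nat (4 * int p - r) then 1 else 0))"
proof -
  have 1: "4 * int p dvd r - int l \<longleftrightarrow> r = int l"
    using dvd_small_int[of "4 * int p" "r - int l"] l r by auto
  have 2: "4 * int p dvd r + int l \<longleftrightarrow> (r = 0 \<and> l = 0) \<or> r + int l = 4 * int p"
  proof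
    assume *: "4 * int p dvd r + int l"
    show "(r = 0 \<and> l = 0) \<or> r + int l = 4 * int p"
    proof (cases "r + int l < 4 * int p")
      case True
      thus ?thesis using dvd_small_int[OF *] l r by auto
    next
      case False
      have "4 * int p dvd r + int l - 4 * int p" using * by simp
      thus ?thesis using dvd_small_int[of "4 * int p" "r + int l - 4 * int p"] False l r by auto
    qed
  qed auto
  have 3: "4 * int p dvd r - int l - 2 * int p \<longleftrightarrow> r = int l + 2 * int p"
    using dvd_small_int[of "4 * int p" "r - int l - 2 * int p"] l r by auto
  have 4: "4 * int p dvd r + int l - 2 * int p \<longleftrightarrow> r + int l = 2 * int p"
    using dvd_small_int[of "4 * int p" "r + int l - 2 * int p"] l r by auto
  consider "r < int p" | "r = int p" | "r = 3 * int p" | "int p < r" "r < 2 * int p"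
    | "2 * int p \<le> r" "r < 3 * int p" | "3 * int p < r"
    by linarith
  thus ?thesis
    unfolding freq_coeff_def 1 2 3 4 by cases (use l r in \<open>simp, linarith?\<close>)+
qed

lemma sum_freq_coeff:
  assumes p: "0 < p" and t: "odd t"
  shows "(\<Sum>j<p. of_rat (freq_coeff p a j) * cos (pi * real (t * j) / real (2 * p)))
         = cos (pi * real t * of_int a / real (2 * p))"
proof -
  define F where "F = (\<lambda>x :: int. cos (pi * real t * of_int x / real (2 * p)))"
  have F_shift: "F (x + 2 * int p) = - F x" for x
  proof -
    have "pi * real t * of_int (x + 2 * int p) / real (2 * p)
        = pi * real t * of_int x / real (2 * p) + real t * pi"
      using p by (simp add: field_simps)
    thus ?thesis using t by (simp add: F_def cos_add)
  qed
  have F_minus: "F (- x) = F x" for x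
    by (simp add: F_def)
  have F_period: "F (x + 4 * int p * s) = F x" for x s
  proof -
    have "pi * real t * of_int (x + 4 * int p * s) / real (2 * p)
        = pi * real t * of_int x / real (2 * p) + 2 * pi * of_int (int t * s)"
      using p by (simp add: field_simps)
    thus ?thesis
      by (simp only: F_def cos_add cos_int_2pin sin_int_2pin mult_1_right mult_zero_right diff_0_right)
  qed
  have F_p: "F (int p) = 0"
    using F_shift[of "- int p"] F_minus[of "int p"] by simp
  define r where "r = a mod (4 * int p)"
  define s where "s = a div (4 * int p)"
  have a: "a = r + 4 * int p * s" by (simp add: r_def s_def)
  have r: "0 \<le> r" "r < 4 * int p" using p by (simp_all add: r_def)
  have Fa: "F a = F r" unfolding a by (rule F_period)
  have red: "freq_coeff p a j = freq_coeff p r j" for j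
  proof -
    have *: "4 * int p dvd a + x \<longleftrightarrow> 4 * int p dvd r + x" for x
    proof -
      have "a + x = 4 * int p * s + (r + x)" by (simp add: a)
      thus ?thesis by (metis dvd_add_right_iff dvd_triv_left)
    qed
    show ?thesis
      using *[of "- int j"] *[of "int j"] *[of "- int j - 2 * int p"] *[of "int j - 2 * int p"]
      by (simp add: freq_coeff_def algebra_simps)
  qed
  have *: "cos (pi * real (t * j) / real (2 * p)) = F (int j)" for j
    by (simp add: F_def mult.assoc)
  have "(\<Sum>j<p. of_rat (freq_coeff p a j) * F (int j)) = F r"
  proof -
    consider "r < int p" | "r = int p" | "r = 3 * int p" | "int p < r" "r < 2 * int p"
      | "2 * int p \<le> r" "r < 3 * int p" | "3 * int p < r"
      by linarith
    thus ?thesis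
    proof cases
      case 1
      have "(\<Sum>j<p. of_rat (freq_coeff p a j) * F (int j)) = (\<Sum>j<p. if j = nat r then F (int j) else 0)"
        using 1 r by (intro sum.cong refl) (simp add: red freq_coeff_reduced)
      also have "\<dots> = F r" using 1 r by (simp add: sum.delta) 
      finally show ?thesis .
    next
      case 2
      thus ?thesis using r F_p by (simp add: red freq_coeff_reduced)
    next
      case 3
      have "F r = 0" using F_shift[of "int p"] F_p 3 by simp
      thus ?thesis using 3 r p by (simp add: red freq_coeff_reduced)
    next
      case 4
      have "(\<Sum>j<p. of_rat (freq_coeff p a j) * F (int j))
          = (\<Sum>j<p. if j = nat (2 * int p - r) then - F (int j) else 0)"
        using 4 r by (intro sum.cong refl) (simp add: red freq_coeff_reduced)
      also have "\<dots> = - F (2 * int p - r)" using 4 by (simp add: sum.delta nat_less_iff)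
      also have "\<dots> = F r" using F_shift[of "- r"] F_minus[of r] by (simp add: algebra_simps)
      finally show ?thesis .
    next
      case 5
      have "(\<Sum>j<p. of_rat (freq_coeff p a j) * F (int j))
          = (\<Sum>j<p. if j = nat (r - 2 * int p) then - F (int j) else 0)"
        using 5 r p by (intro sum.cong refl) (simp add: red freq_coeff_reduced)
      also have "\<dots> = - F (r - 2 * int p)" using 5 by (simp add: sum.delta nat_less_iff)
      also have "\<dots> = F r" using F_shift[of "r - 2 * int p"] by simp
      finally show ?thesis .
    next
      case 6
      have "(\<Sum>j<p. of_rat (freq_coeff p a j) * F (int j))
          = (\<Sum>j<p. if j = nat (4 * int p - r) then F (int j) else 0)"
        using 6 r by (intro sum.cong refl) (simp add: red freq_coeff_reduced)
      also have "\<dots> = F (4 * int p - r)" using 6 r by (simp add: sum.delta nat_less_iff)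
      also have "\<dots> = F r" using F_period[of "- r" 1] F_minus[of r] by (simp add: algebra_simps)
      finally show ?thesis .
    qed
  qed
  thus ?thesis by (simp only: * Fa[symmetric]) (simp add: F_def)
qed

lemma pair_index_less:
  fixes i j s u :: nat
  assumes "i < s" "j < u"
  shows "j * s + i < u * s"
proof -
  have "j * s + i < Suc j * s" using assms by simp
  also have "\<dots> \<le> u * s" using assms by (intro mult_right_mono) auto
  finally show ?thesis .
qed

lemma sum_div_mod:
  fixes g :: "nat \<Rightarrow> nat \<Rightarrow> 'a :: comm_monoid_add"
  assumes "0 < r"
  shows "(\<Sum>l<p * r. g (l div r) (l mod r)) = (\<Sum>i<p. \<Sum>j<r. g i j)"
proof -
  have "(\<Sum>l<p * r. g (l div r) (l mod r)) = (\<Sum>(i, j)\<in>{..<p} \<times> {..<r}. g i j)"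
    using assms
    by (intro sum.reindex_bij_witness[of _ "\<lambda>(i, j). i * r + j" "\<lambda>l. (l div r, l mod r)"])
      (auto simp: less_mult_imp_div_less intro: pair_index_less)
  thus ?thesis by (simp add: sum.cartesian_product)
qed

theorem matrix_of_prime_factor:
  assumes "coprime p r" "0 < p" "0 < r"
  shows "matrix_of (prime_factor p r \<mu> \<nu>) = dct2 (p * r)"
proof -
  define c where "c = (\<lambda>q n k. cos (pi * real ((2 * n + 1) * k) / real (2 * q)))"
  let ?N = "p * r"
  let ?I = "map_mat of_rat (pf_input p r) :: real mat"
  let ?T = "map_mat of_rat (pf_transpose p r) :: real mat"
  let ?O = "map_mat of_rat (pf_output p r) :: real mat"
  let ?A = "copies_mat r (dct2 p)"
  let ?B = "copies_mat p (dct2 r)"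
  have dims [simp]: "dim_row (pf_input p r) = ?N" "dim_col (pf_input p r) = ?N"
    "dim_row (pf_transpose p r) = ?N" "dim_col (pf_transpose p r) = ?N"
    "dim_row (pf_output p r) = ?N" "dim_col (pf_output p r) = ?N"
    "dim_row ?A = ?N" "dim_col ?A = ?N" "dim_row ?B = ?N" "dim_col ?B = ?N"
    by (simp_all add: pf_input_def pf_transpose_def pf_output_def copies_mat_def)
  have AI: "(?A * ?I) $$ (l, n) = (if l div p = fold_index r n then c p n (l mod p) else 0)"
    if l: "l < ?N" and n: "n < ?N" for l n
  proof -
    let ?s = "fold_index r n * p + fold_index p n"
    note fl = fold_index_less[OF \<open>0 < p\<close>, of n] fold_index_less[OF \<open>0 < r\<close>, of n]
    have s: "?s < ?N" using pair_index_less[OF fl] by (simp add: mult.commute)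
    have "(?A * ?I) $$ (l, n) = (\<Sum>i<?N. ?A $$ (l, i) * ?I $$ (i, n))"
      using l n by (subst index_mult_sum) simp_all
    also have "\<dots> = (\<Sum>i<?N. if i = ?s then ?A $$ (l, i) else 0)"
      using n by (intro sum.cong refl) (simp add: pf_input_def)
    also have "\<dots> = ?A $$ (l, ?s)"
      using s by simp
    also have "\<dots> = (if l div p = fold_index r n then dct2 p $$ (l mod p, fold_index p n) else 0)"
      using l s fl by (simp add: copies_mat_def mult.commute)
    finally show ?thesis
      using fl assms cos_fold_index[of p n "l mod p"] by (simp add: dct2_def c_def)
  qed
  have TAI: "(?T * (?A * ?I)) $$ (l, n)
      = (if l mod r = fold_index r n then c p n (l div r) else 0)"
    if l: "l < ?N" and n: "n < ?N" for l n
  proof -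
    let ?s = "(l mod r) * p + l div r"
    have ld: "l div r < p" using l assms by (simp add: less_mult_imp_div_less)
    have s: "?s < ?N" using pair_index_less[OF ld, of "l mod r" r] assms by (simp add: mult.commute)
    have "(?T * (?A * ?I)) $$ (l, n) = (\<Sum>i<?N. ?T $$ (l, i) * (?A * ?I) $$ (i, n))"
      using l n by (subst index_mult_sum) (simp_all del: index_mult_mat(1))
    also have "\<dots> = (\<Sum>i<?N. if i = ?s then (?A * ?I) $$ (i, n) else 0)"
    proof (intro sum.cong refl)
      fix i assume "i \<in> {..<?N}"
      hence i: "i < ?N" by simp
      have "l div r = i mod p \<and> l mod r = i div p \<longleftrightarrow> i = ?s"
        using ld by (auto simp: mult.commute) 
      thus "?T $$ (l, i) * (?A * ?I) $$ (i, n) = (if i = ?s then (?A * ?I) $$ (i, n) else 0)"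
        using i l by (simp add: pf_transpose_def del: index_mult_mat(1))
    qed
    also have "\<dots> = (?A * ?I) $$ (?s, n)"
      using s by (simp del: index_mult_mat(1))
    finally show ?thesis
      using AI[OF s n] ld by simp
  qed
  have BTAI: "(?B * (?T * (?A * ?I))) $$ (l, n) = c p n (l div r) * c r n (l mod r)"
    if l: "l < ?N" and n: "n < ?N" for l n
  proof -
    let ?s = "l div r * r + fold_index r n"
    have ld: "l div r < p" using l assms by (simp add: less_mult_imp_div_less)
    note fl = fold_index_less[OF \<open>0 < r\<close>, of n]
    have s: "?s < ?N" by (rule pair_index_less[OF fl ld])
    have "(?B * (?T * (?A * ?I))) $$ (l, n) = (\<Sum>i<?N. ?B $$ (l, i) * (?T * (?A * ?I)) $$ (i, n))"
      using l n by (subst index_mult_sum) (simp_all del: index_mult_mat(1))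
    also have "\<dots> = (\<Sum>i<?N. if i = ?s then dct2 r $$ (l mod r, fold_index r n) * c p n (l div r) else 0)"
    proof (intro sum.cong refl)
      fix i assume "i \<in> {..<?N}"
      hence i: "i < ?N" by simp
      have B: "?B $$ (l, i) = (if l div r = i div r then dct2 r $$ (l mod r, i mod r) else 0)"
        using i l by (simp add: copies_mat_def)
      show "?B $$ (l, i) * (?T * (?A * ?I)) $$ (i, n)
          = (if i = ?s then dct2 r $$ (l mod r, fold_index r n) * c p n (l div r) else 0)"
      proof (cases "i = ?s")
        case True
        hence "i div r = l div r" "i mod r = fold_index r n" using fl by simp_all
        thus ?thesis unfolding TAI[OF i n] B using True by simp
      next
        case False
        hence "l div r \<noteq> i div r \<or> i mod r \<noteq> fold_index r n"
          using div_mult_mod_eq[of i r] by metis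
        thus ?thesis unfolding TAI[OF i n] B using False by auto
      qed
    qed
    also have "\<dots> = dct2 r $$ (l mod r, fold_index r n) * c p n (l div r)"
      using s by simp
    finally show ?thesis
      using fl assms cos_fold_index[of r n "l mod r"] by (simp add: dct2_def c_def)
  qed
  obtain u v where uv: "bezout_coefficients (int r) (int p) = (u, v)" by (meson surj_pair)
  have bez: "u * int r + v * int p = 1"
    using bezout_coefficients[OF uv] assms(1) by (simp add: coprime_commute coprime_imp_gcd_eq_1)
  have main: "(?O * (?B * (?T * (?A * ?I)))) $$ (k, n) = dct2 ?N $$ (k, n)"
    if k: "k < ?N" and n: "n < ?N" for k n
  proof -
    define a b where "a = int k * u" and "b = int k * v"
    define t where "t = 2 * n + 1"
    have t: "odd t" by (simp add: t_def)
    define f where "f = (\<lambda>q (x :: int). cos (pi * real t * of_int x / real (2 * q)))"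
    have sc: "(\<Sum>j<q. of_rat (freq_coeff q x j) * c q n j) = f q x" if "0 < q" for q x
      using sum_freq_coeff[OF that t, of x] by (simp add: c_def f_def t_def)
    have prod: "(\<Sum>l<?N. (of_rat (freq_coeff p x (l div r)) * c p n (l div r))
        * (of_rat (freq_coeff r y (l mod r)) * c r n (l mod r))) = f p x * f r y" for x y
    proof -
      have "(\<Sum>l<?N. (of_rat (freq_coeff p x (l div r)) * c p n (l div r))
          * (of_rat (freq_coeff r y (l mod r)) * c r n (l mod r)))
        = (\<Sum>i<p. \<Sum>j<r. (of_rat (freq_coeff p x i) * c p n i) * (of_rat (freq_coeff r y j) * c r n j))"
        using sum_div_mod[OF \<open>0 < r\<close>, where p = p and g = "\<lambda>i j.
            (of_rat (freq_coeff p x i) * c p n i) * (of_rat (freq_coeff r y j) * c r n j)"] .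
      thus ?thesis
        by (simp only: sum_product[symmetric] sc[OF \<open>0 < p\<close>] sc[OF \<open>0 < r\<close>])
    qed
    have "(?O * (?B * (?T * (?A * ?I)))) $$ (k, n)
        = (\<Sum>l<?N. ?O $$ (k, l) * (?B * (?T * (?A * ?I))) $$ (l, n))"
      using k n by (subst index_mult_sum) (simp_all del: index_mult_mat(1))
    also have "\<dots> = (\<Sum>l<?N.
          (of_rat (freq_coeff p a (l div r)) * c p n (l div r))
            * (of_rat (freq_coeff r b (l mod r)) * c r n (l mod r))
        - (of_rat (freq_coeff p (int p - a) (l div r)) * c p n (l div r))
            * (of_rat (freq_coeff r (int r - b) (l mod r)) * c r n (l mod r)))"
    proof (intro sum.cong refl)
      fix l assume "l \<in> {..<?N}"
      hence l: "l < ?N" by simp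
      have O: "?O $$ (k, l) = of_rat (freq_coeff p a (l div r)) * of_rat (freq_coeff r b (l mod r))
          - of_rat (freq_coeff p (int p - a) (l div r)) * of_rat (freq_coeff r (int r - b) (l mod r))"
        using k l by (simp add: pf_output_def uv a_def b_def of_rat_diff of_rat_mult Let_def)
      show "?O $$ (k, l) * (?B * (?T * (?A * ?I))) $$ (l, n)
        = (of_rat (freq_coeff p a (l div r)) * c p n (l div r))
            * (of_rat (freq_coeff r b (l mod r)) * c r n (l mod r))
        - (of_rat (freq_coeff p (int p - a) (l div r)) * c p n (l div r))
            * (of_rat (freq_coeff r (int r - b) (l mod r)) * c r n (l mod r))"
        unfolding BTAI[OF l n] O by (simp add: algebra_simps)
    qed
    also have "\<dots> = f p a * f r b - f p (int p - a) * f r (int r - b)"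
      by (simp only: sum_subtractf prod)
    also have "f p (int p - a) * f r (int r - b)
        = sin (pi * real t * of_int a / real (2 * p)) * sin (pi * real t * of_int b / real (2 * r))"
    proof -
      have cz: "cos (real t * pi / 2) = 0" and s1: "sin (real t * pi / 2) ^ 2 = 1"
      proof -
        have "cos (real t * pi / 2) = cos (real n * pi + pi / 2)"
          by (simp add: t_def field_simps)
        thus *: "cos (real t * pi / 2) = 0"
          by (simp add: cos_add)
        show "sin (real t * pi / 2) ^ 2 = 1"
          using sin_cos_squared_add[of "real t * pi / 2"] * by simp
      qed
      have "f q (int q - x) = sin (real t * pi / 2) * sin (pi * real t * of_int x / real (2 * q))"
        if "0 < q" for q x
      proof -
        have "pi * real t * of_int (int q - x) / real (2 * q)
            = real t * pi / 2 - pi * real t * of_int x / real (2 * q)"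
          using that by (simp add: field_simps)
        thus ?thesis by (simp only: f_def cos_diff cz mult_zero_left add_0_left)
      qed
      thus ?thesis using s1 assms by (simp add: power2_eq_square algebra_simps)
    qed
    also have "f p a * f r b
        - sin (pi * real t * of_int a / real (2 * p)) * sin (pi * real t * of_int b / real (2 * r))
        = cos (pi * real t * of_int a / real (2 * p) + pi * real t * of_int b / real (2 * r))"
      by (simp add: f_def cos_add)
    also have "pi * real t * of_int a / real (2 * p) + pi * real t * of_int b / real (2 * r)
        = pi * real t * of_int (a * int r + b * int p) / real (2 * ?N)"
      using assms by (simp add: field_simps)
    also have "a * int r + b * int p = int k"
      using bez by (metis a_def b_def distrib_left mult.assoc mult.right_neutral)
    also have "cos (pi * real t * of_int (int k) / real (2 * ?N)) = dct2 ?N $$ (k, n)"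
      using k n by (simp add: dct2_def t_def algebra_simps)
    finally show ?thesis .
  qed
  show ?thesis
    unfolding prime_factor_def matrix_of.simps
    by (rule eq_matI) (simp_all add: main del: index_mult_mat(1))
qed

end

theory Submission
  imports Defs
begin

text \<open>Both counts contain \<open>2 ^ m * \<mu>\<close>. Cancelling it, doubling, and dividing
  by \<open>q > 0\<close> leaves \<open>m * 2 ^ m = 2 * (2 ^ (m + 1) - m - 2)\<close>, that is,
  \<open>(4 - m) * 2 ^ m = 2 * m + 4\<close> over the integers. This holds for m = 0, 1, 2 and fails
  for m = 3 (8 against 10); from m = 4 on the left side is no longer positive.
  \<open>half_mult_pow2_eq_bound_iff\<close> carries this step.\<close>

text \<open>Each level doubles the previous count and adds half the new length for the diagonal
  stage. Doubling keeps m/2 within the naturals.\<close>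

lemma twice_mults_kok: "2 * mults (kok q \<mu> m) = 2 * (2 ^ m * \<mu>) + m * (q * 2 ^ m)"
  by (induction m) (simp_all add: Let_def algebra_simps)

lemma dct2_pow2_bound_add: "dct2_pow2_bound m + m + 2 = 2 ^ (m + 1)"
proof -
  have "m + 2 \<le> 2 ^ (m + 1)"
    by (induction m) auto
  thus ?thesis by (simp add: dct2_pow2_bound_def)
qed

text \<open>The cost is monotone in \<open>\<nu>\<close>, so the minimum is attained at the lower
  bound itself.\<close>

lemma prime_factor_best_eq: "prime_factor_best q \<mu> m = 2 ^ m * \<mu> + q * dct2_pow2_bound m"
  unfolding prime_factor_best_def
  by (rule Least_equality) (auto simp: prime_factor_def)

lemma half_mult_pow2_eq_bound_iff: "m * 2 ^ m = 2 * dct2_pow2_bound m \<longleftrightarrow> m \<le> 2"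
proof -
  have bound: "2 * dct2_pow2_bound m + 2 * m + 4 = 4 * 2 ^ m"
    using dct2_pow2_bound_add[of m] by simp
  consider "m = 0" | "m = 1" | "m = 2" | "m = 3" | "4 \<le> m" by linarith
  thus ?thesis
  proof cases
    case 5
    \<comment> \<open>By \<open>bound\<close>, \<open>4 * 2 ^ m\<close> already exceeds twice the
      lower bound by \<open>2 * m + 4\<close>.\<close>
    have "4 * 2 ^ m \<le> m * 2 ^ m" using 5 by (intro mult_right_mono) auto
    thus ?thesis using bound 5 by linarith
  qed (use bound in auto)
qed

theorem theorem1:
  fixes q m N \<mu> :: nat
  assumes "odd q" and "N = q * 2 ^ m"
  shows "real (mults (kok q \<mu> m)) = 2 ^ m * real \<mu> + real m / 2 * real N
    \<and> real (prime_factor_best q \<mu> m)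
        = 2 ^ m * real \<mu> + real q * (2 ^ (m + 1) - real m - 2)
    \<and> (mults (kok q \<mu> m) = prime_factor_best q \<mu> m \<longleftrightarrow> m \<le> 2)"
proof (intro conjI)
  have "2 * real (mults (kok q \<mu> m)) = real (2 * (2 ^ m * \<mu>) + m * (q * 2 ^ m))"
    by (simp only: twice_mults_kok[symmetric] of_nat_mult of_nat_numeral)
  thus "real (mults (kok q \<mu> m)) = 2 ^ m * real \<mu> + real m / 2 * real N"
    by (simp add: assms(2))
next
  have "real (dct2_pow2_bound m + m + 2) = real (2 ^ (m + 1))"
    by (simp only: dct2_pow2_bound_add)
  hence "real (dct2_pow2_bound m) = 2 ^ (m + 1) - real m - 2"
    by simp
  thus "real (prime_factor_best q \<mu> m)
      = 2 ^ m * real \<mu> + real q * (2 ^ (m + 1) - real m - 2)"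
    by (simp add: prime_factor_best_eq)
next
  \<comment> \<open>Oddness serves only to exclude \<open>q = 0\<close>, so that \<open>q\<close>
    can be cancelled.\<close>
  have "q > 0" using assms(1) by (rule odd_pos)
  have "mults (kok q \<mu> m) = prime_factor_best q \<mu> m
      \<longleftrightarrow> 2 * mults (kok q \<mu> m) = 2 * prime_factor_best q \<mu> m"
    by simp
  also have "\<dots> \<longleftrightarrow> q * (m * 2 ^ m) = q * (2 * dct2_pow2_bound m)"
    unfolding twice_mults_kok prime_factor_best_eq by (simp add: algebra_simps)
  also have "\<dots> \<longleftrightarrow> m \<le> 2"
    using \<open>q > 0\<close> by (simp add: half_mult_pow2_eq_bound_iff)
  finally show "mults (kok q \<mu> m) = prime_factor_best q \<mu> m \<longleftrightarrow> m \<le> 2" .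
qed

end
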